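(* Let the set $R\subseteq \mathbb{R}_{\geq 0}$ satisfy the 4-values condition and let $(\mathrm{A},\mathrm{B})$, with $\mathrm{A}=(A;d_\mathrm{A})$, $\mathrm{B}=(B;d_\mathrm{B})$ and $\operatorname{dist}(\mathrm{A})\cup \operatorname{dist}(\mathrm{B})\subseteq R$, be an amalgamation instance. If $A\cup B$ is finite or if $R$ is closed, then $\amalg_R(\mathrm{A},\mathrm{B})\neq\emptyset$; that is, there exists a metric space $\mathrm{C}=(A\cup B;d_\mathrm{C})$ with $\operatorname{dist}(\mathrm{C})\subseteq R$ whose restriction to $A$ is $\mathrm{A}$ and whose restriction to $B$ is $\mathrm{B}$.
   Context: For a metric space $\mathrm{M}=(M;d)$ let $\operatorname{dist}(\mathrm{M})=\{d(x,y)\mid x,y\in M\}$. A triple $(a,b,c)$ of non-negative numbers is metric if $a\leq b+c$, $b\leq a+c$ and $c\leq a+b$. Write $x\leadsto(a,b,c,d)$ if the triples $(x,a,b)$ and $(x,c,d)$ are metric and $a\geq \max\{b,c,d\}$. A set $R\subseteq\mathbb{R}_{\ge 0}$ satisfies the 4-values condition if for all $a,b,c,d\in R$ for which there is $x\in R$ with $x\leadsto(a,b,c,d)$ there is $y\in R$ with $y\leadsto(a,d,c,b)$. A pair of metric spaces $(\mathrm{A},\mathrm{B})$, $\mathrm{A}=(A;d_\mathrm{A})$, $\mathrm{B}=(B;d_\mathrm{B})$, is an amalgamation instance if $d_\mathrm{A}(x,y)=d_\mathrm{B}(x,y)$ for all $x,y\in A\cap B$. Then $\amalg_R(\mathrm{A},\mathrm{B})$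 is the set of metric spaces $\mathrm{C}=(A\cup B;d_\mathrm{C})$ with $d_\mathrm{C}$ extending $d_\mathrm{A}$ and $d_\mathrm{B}$ and $\operatorname{dist}(\mathrm{C})\subseteq R$.
   Formalization: Added hypothesis: for all x in A∖B and y in B∖A some positive r in R satisfies r ≤ d_A(x,z)+d_B(z,y) for every z in A∩B. It is necessary for the conclusion, and without it the claim fails (e.g. R={0}, A={p}, B={q}, p≠q). *)

theory Defs
  imports "HOL-Analysis.Analysis"
begin

definition dist_set :: "'a metric \<Rightarrow> real set" where
  "dist_set M = {mdist M x y | x y. x \<in> mspace M \<and> y \<in> mspace M}"

definition metric_triple :: "real \<Rightarrow> real \<Rightarrow> real \<Rightarrow> bool" where
  "metric_triple a b c \<longleftrightarrow>
     0 \<le> a \<and> 0 \<le> b \<and> 0 \<le> c \<and> a \<le> b + c \<and> b \<le> a + c \<and> c \<le> a + b"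

definition leads_to :: "real \<Rightarrow> real \<Rightarrow> real \<Rightarrow> real \<Rightarrow> real \<Rightarrow> bool" where
  "leads_to x a b c d \<longleftrightarrow>
     metric_triple x a b \<and> metric_triple x c d \<and> a \<ge> Max {b, c, d}"

definition four_values :: "real set \<Rightarrow> bool" where
  "four_values R \<longleftrightarrow>
     (\<forall>a\<in>R. \<forall>b\<in>R. \<forall>c\<in>R. \<forall>d\<in>R.
        (\<exists>x\<in>R. leads_to x a b c d) \<longrightarrow> (\<exists>y\<in>R. leads_to y a d c b))"

definition amalgamation_instance :: "'a metric \<Rightarrow> 'a metric \<Rightarrow> bool" where
  "amalgamation_instance A B \<longleftrightarrow>
     (\<forall>x \<in> mspace A \<inter> mspace B. \<forall>y \<in> mspace A \<inter> mspace B. mdist A x y = mdist B x y)"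

text \<open>Agreement of distances is only required on the carriers, since the values of \<open>mdist M\<close>
  outside \<open>mspace M\<close> carry no meaning.\<close>

definition amalgams :: "real set \<Rightarrow> 'a metric \<Rightarrow> 'a metric \<Rightarrow> 'a metric set" where
  "amalgams R A B =
     {C. mspace C = mspace A \<union> mspace B \<and>
         (\<forall>x \<in> mspace A. \<forall>y \<in> mspace A. mdist C x y = mdist A x y) \<and>
         (\<forall>x \<in> mspace B. \<forall>y \<in> mspace B. mdist C x y = mdist B x y) \<and>
         dist_set C \<subseteq> R}"

text \<open>
  Two new points \<open>x\<close> and \<open>y\<close> from different sides must get a positive distance in any amalgam
  whose carrier is the plain union. The following condition says that, for each such pair taken on
  its own, some positive element of \<open>R\<close> respects the upper bounds that the triangle inequality
  imposes through the common points. It is necessary for the existence of an amalgam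
  (\<open>amalgams_imp_separated\<close>) and automatic for finite spaces with a common point
  (\<open>separated_if_finite\<close>). If \<open>A \<union> B\<close> is finite or \<open>R\<close> is closed, it fails only if \<open>R\<close> has
  no positive element and the spaces are nonempty and disjoint, or if a sequence of common points
  converges to \<open>x\<close> in \<open>A\<close> and to \<open>y\<close> in \<open>B\<close>; both do happen under the remaining hypotheses of
  the amalgamation theorem (\<open>separated_needed_finite\<close>, \<open>separated_needed_closed\<close>).
\<close>

definition separated_instance :: "real set \<Rightarrow> 'a metric \<Rightarrow> 'a metric \<Rightarrow> bool" where
  "separated_instance R A B \<longleftrightarrow>
     (\<forall>x \<in> mspace A - mspace B. \<forall>y \<in> mspace B - mspace A.
        \<exists>r\<in>R. 0 < r \<and> (\<forall>z \<in> mspace A \<inter> mspace B. r \<le> mdist A x z + mdist B z y))"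

lemma amalgams_imp_separated:
  assumes "amalgams R A B \<noteq> {}"
  shows "separated_instance R A B"
proof -
  obtain C where C: "mspace C = mspace A \<union> mspace B"
    and CA: "\<And>x y. x \<in> mspace A \<Longrightarrow> y \<in> mspace A \<Longrightarrow> mdist C x y = mdist A x y"
    and CB: "\<And>x y. x \<in> mspace B \<Longrightarrow> y \<in> mspace B \<Longrightarrow> mdist C x y = mdist B x y"
    and CR: "dist_set C \<subseteq> R"
    using assms by (auto simp: amalgams_def)
  interpret C: Metric_space "mspace C" "mdist C" by (rule Metric_space_mspace_mdist)
  show ?thesis
    unfolding separated_instance_def
  proof (intro ballI)
    fix x y assume x: "x \<in> mspace A - mspace B" and y: "y \<in> mspace B - mspace A"
    have xy: "x \<in> mspace C" "y \<in> mspace C" "x \<noteq> y" using x y C by auto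
    have "mdist C x y \<in> R" using CR xy by (auto simp: dist_set_def)
    moreover have "0 < mdist C x y" using xy by simp
    moreover have "mdist C x y \<le> mdist A x z + mdist B z y" if "z \<in> mspace A \<inter> mspace B" for z
      using C.triangle[of x z y] CA[of x z] CB[of z y] that x y C by auto
    ultimately show "\<exists>r\<in>R. 0 < r \<and> (\<forall>z \<in> mspace A \<inter> mspace B. r \<le> mdist A x z + mdist B z y)"
      by blast
  qed
qed

lemma separated_if_finite:
  assumes "finite (mspace A \<union> mspace B)" "mspace A \<inter> mspace B \<noteq> {}" "dist_set A \<union> dist_set B \<subseteq> R"
  shows "separated_instance R A B"
  unfolding separated_instance_def
proof (intro ballI)
  fix x y assume x: "x \<in> mspace A - mspace B" and y: "y \<in> mspace B - mspace A"
  let ?S = "(\<lambda>z. mdist A x z) ` (mspace A \<inter> mspace B)"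
  have S: "finite ?S" "?S \<noteq> {}" using assms by auto
  then obtain w where w: "w \<in> mspace A \<inter> mspace B" "Min ?S = mdist A x w"
    using Min_in[OF S] by (metis imageE)
  have "mdist A x w \<in> R" using w x assms(3) by (auto simp: dist_set_def)
  moreover have "0 < mdist A x w"
    using w x Metric_space.mdist_pos_less[OF Metric_space_mspace_mdist, of x w A] by auto
  moreover have "mdist A x w \<le> mdist A x z + mdist B z y" if "z \<in> mspace A \<inter> mspace B" for z
  proof -
    have "mdist A x w \<le> mdist A x z" using Min_le[OF S(1)] that w(2) by (metis imageI)
    then show ?thesis using mdist_nonneg[of B z y] by linarith
  qed
  ultimately show "\<exists>r\<in>R. 0 < r \<and> (\<forall>z \<in> mspace A \<inter> mspace B. r \<le> mdist A x z + mdist B z y)"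
    by blast
qed

lemma separated_needed_finite:
  "\<exists>(R::real set) (A::bool metric) B. R \<subseteq> {0..} \<and> four_values R \<and> amalgamation_instance A B \<and>
     dist_set A \<union> dist_set B \<subseteq> R \<and> finite (mspace A \<union> mspace B) \<and> amalgams R A B = {}"
proof -
  have M: "Metric_space {b} (\<lambda>x y. 0)" for b :: bool
    by unfold_locales auto
  define A where "A = metric ({True}, \<lambda>x y::bool. 0)"
  define B where "B = metric ({False}, \<lambda>x y::bool. 0)"
  have AB: "mspace A = {True}" "mdist A = (\<lambda>x y. 0)" "mspace B = {False}" "mdist B = (\<lambda>x y. 0)"
    using Metric_space.mspace_metric[OF M] Metric_space.mdist_metric[OF M]
    by (simp_all add: A_def B_def)
  have "\<not> separated_instance {0} A B"
    by (auto simp: separated_instance_def AB intro: exI[of _ True])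
  then have "amalgams {0} A B = {}"
    using amalgams_imp_separated by blast
  moreover have "dist_set A \<union> dist_set B \<subseteq> {0}"
    unfolding dist_set_def AB by blast
  ultimately show ?thesis
    by (intro exI[of _ "{0}"] exI[of _ A] exI[of _ B])
      (simp add: four_values_def amalgamation_instance_def AB)
qed

lemma separated_needed_closed:
  "\<exists>(R::real set) (A::real metric) B. R \<subseteq> {0..} \<and> four_values R \<and> amalgamation_instance A B \<and>
     dist_set A \<union> dist_set B \<subseteq> R \<and> closed R \<and> mspace A \<inter> mspace B \<noteq> {} \<and> amalgams R A B = {}"
proof -
  let ?d = "\<lambda>x y::real. \<bar>max x 0 - max y 0\<bar>"
  have M: "Metric_space ({a} \<union> {0<..}) ?d" if "a \<le> 0" for a
    using that by unfold_locales (auto simp: max_def split: if_splits)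
  define A where "A = metric ({0} \<union> {0<..}, ?d)"
  define B where "B = metric ({-1} \<union> {0<..}, ?d)"
  have AB: "mspace A = {0} \<union> {0<..}" "mdist A = ?d" "mspace B = {-1} \<union> {0<..}" "mdist B = ?d"
    using Metric_space.mspace_metric[OF M[of 0]] Metric_space.mdist_metric[OF M[of 0]]
      Metric_space.mspace_metric[OF M[of "-1"]] Metric_space.mdist_metric[OF M[of "-1"]]
    by (simp_all add: A_def B_def)
  have "\<not> separated_instance {0..} A B"
  proof
    assume "separated_instance {0..} A B"
    moreover have "0 \<in> mspace A - mspace B" "-1 \<in> mspace B - mspace A" by (simp_all add: AB)
    ultimately obtain r :: real
      where r: "0 < r" "\<forall>z \<in> mspace A \<inter> mspace B. r \<le> mdist A 0 z + mdist B z (-1)"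
      unfolding separated_instance_def by blast
    have "r / 4 \<in> mspace A \<inter> mspace B" using r(1) by (simp add: AB)
    with r(2) have "r \<le> mdist A 0 (r/4) + mdist B (r/4) (-1)" by blast
    with r(1) show False by (simp add: AB max_def)
  qed
  then have "amalgams {0..} A B = {}"
    using amalgams_imp_separated by blast
  moreover have "four_values {0..}"
    unfolding four_values_def
  proof (intro ballI impI)
    fix a b c d :: real
    assume "a \<in> {0..}" "b \<in> {0..}" "c \<in> {0..}" "d \<in> {0..}" "\<exists>x\<in>{0..}. leads_to x a b c d"
    then show "\<exists>y\<in>{0..}. leads_to y a d c b"
      by (intro bexI[of _ "max (a - d) \<bar>c - b\<bar>"])
        (auto simp: leads_to_def metric_triple_def)
  qed
  moreover have "1 \<in> mspace A \<inter> mspace B" by (simp add: AB)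
  moreover have "dist_set A \<union> dist_set B \<subseteq> {0..}" by (auto simp: dist_set_def)
  moreover have "amalgamation_instance A B" by (simp add: amalgamation_instance_def AB)
  ultimately show ?thesis
    by (intro exI[of _ "{0..}"] exI[of _ A] exI[of _ B]) auto
qed

end

theory Submission
  imports Defs
begin

text \<open>
  Read the four-values condition as a statement about quadrilaterals with side lengths in \<open>R\<close>:
  if one diagonal can be given a length in \<open>R\<close>, then so can the other
  (\<open>four_values_quadrilateral\<close>). In terms of the operation
  \<open>a \<oplus> b = max {r \<in> R. r \<le> a + b}\<close> this makes \<open>\<oplus>\<close> associative;
  \<open>four_values_reassociate\<close> expresses this by inequalities, so that it makes sense even where
  the maximum does not exist.

  If \<open>R\<close> is closed and the spaces have a common point, all missing distances can be chosen at
  once: \<open>x \<in> A\<close> and \<open>y \<in> B\<close> get the largest element of \<open>R\<close> that respects the upper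
  bounds \<open>d\<^sub>A(x,z) + d\<^sub>B(z,y)\<close> for all common points \<open>z\<close>. This is the shortest-path
  amalgam with \<open>\<oplus>\<close> in place of \<open>+\<close>, and associativity gives the triangle inequalities
  (\<open>free_dist_side\<close>, \<open>free_dist_base\<close>). As the largest choice is at least the positive
  number provided by separatedness, distinct points keep a positive distance, however many common
  points there are.

  If \<open>R\<close> is not closed, the largest element may not exist, but then \<open>A \<union> B\<close> is finite
  and one missing distance at a time suffices. For a single pair \<open>(x,y)\<close> the lower bounds
  \<open>\<bar>d\<^sub>A(x,z) - d\<^sub>B(z,y)\<bar>\<close> and the upper bounds have a maximum, attained at some
  \<open>z\<close>, and a minimum, attained at some \<open>w\<close>, and the quadrilateral rule for \<open>x, z, y, w\<close>
  with diagonal \<open>zw\<close> gives an element of \<open>R\<close> between them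
  (\<open>finite_one_point_distance\<close>).

  If the spaces have no common point, one pair \<open>(a,b)\<close> may be given any positive distance in
  \<open>R\<close>. Then \<open>{a,b}\<close> is amalgamated with \<open>B\<close> over \<open>b\<close>, and the result with
  \<open>A\<close> over \<open>a\<close>.
\<close>

section \<open>The four-values condition as a rule for quadrilaterals\<close>

text \<open>The relation \<open>\<leadsto>\<close> demands that the first side be the longest. This is no
  restriction, because the symmetries of the square carry any side to the first place and preserve
  the pair of diagonals. Here \<open>a, b, c, d\<close> are the sides in cyclic order, \<open>p\<close> is the diagonal
  that cuts off \<open>a, b\<close>, and \<open>q\<close> is the one that cuts off \<open>b, c\<close>.\<close>

lemma four_values_quadrilateral:
  assumes "four_values R" "p \<in> R" "a \<in> R" "b \<in> R" "c \<in> R" "d \<in> R"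
    and pab: "metric_triple p a b" and pcd: "metric_triple p c d"
  obtains q where "q \<in> R" "metric_triple q a d" "metric_triple q b c"
proof -
  have sym: "metric_triple u v w \<longleftrightarrow> metric_triple u w v" for u v w
    by (auto simp: metric_triple_def)
  have *: "\<exists>y\<in>R. metric_triple y a' d' \<and> metric_triple y c' b'"
    if h: "a' \<in> R" "b' \<in> R" "c' \<in> R" "d' \<in> R" "a' \<ge> b'" "a' \<ge> c'" "a' \<ge> d'"
      "metric_triple p a' b'" "metric_triple p c' d'" for a' b' c' d'
  proof -
    have "leads_to p a' b' c' d'"
      using h by (simp add: leads_to_def)
    then obtain y where "y \<in> R" "leads_to y a' d' c' b'"
      using assms(1,2) h unfolding four_values_def by blast
    then show ?thesis by (auto simp: leads_to_def)
  qed
  consider "a \<ge> b" "a \<ge> c" "a \<ge> d" | "b \<ge> a" "b \<ge> c" "b \<ge> d"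
    | "c \<ge> a" "c \<ge> b" "c \<ge> d" | "d \<ge> a" "d \<ge> b" "d \<ge> c"
    by linarith
  then have "\<exists>y\<in>R. metric_triple y a d \<and> metric_triple y b c"
  proof cases
    case 1 then show ?thesis using *[of a b c d] assms sym by blast
  next
    case 2 then show ?thesis using *[of b a d c] assms sym by blast
  next
    case 3 then show ?thesis using *[of c d a b] assms sym by blast
  next
    case 4 then show ?thesis using *[of d c b a] assms sym by blast
  qed
  then show thesis using that by blast
qed

text \<open>Associativity of \<open>\<oplus>\<close>: an \<open>s\<close> that is reachable as \<open>(a \<oplus> b) \<oplus> c\<close> is
  reachable as \<open>a \<oplus> (b \<oplus> c)\<close>. It is the quadrilateral rule for the sides
  \<open>a, b, c, s\<close> and the diagonal \<open>t\<close>.\<close>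

lemma four_values_reassociate:
  assumes "four_values R" "R \<subseteq> {0..}"
    and "s \<in> R" "t \<in> R" "a \<in> R" "b \<in> R" "c \<in> R" "t \<le> a + b" "s \<le> t + c"
  shows "\<exists>q\<in>R. q \<le> b + c \<and> s \<le> a + q"
proof -
  \<comment> \<open>Enlarging \<open>t\<close> and \<open>s\<close> keeps the hypotheses and makes the remaining triangle
    inequalities for both triangles hold.\<close>
  define t' where "t' = max t (max a b)"
  define s' where "s' = max s (max t' c)"
  have R: "t' \<in> R" "s' \<in> R"
    using assms by (auto simp: t'_def s'_def max_def)
  have nonneg: "0 \<le> s" "0 \<le> t" "0 \<le> a" "0 \<le> b" "0 \<le> c"
    using assms by auto
  have "metric_triple t' a b" "metric_triple t' c s'"
    using assms nonneg by (auto simp: metric_triple_def t'_def s'_def)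
  then obtain q where "q \<in> R" "metric_triple q a s'" "metric_triple q b c"
    using four_values_quadrilateral[of R t' a b c s'] R assms by blast
  then show ?thesis
    by (auto simp: metric_triple_def s'_def)
qed

section \<open>Gluing metric spaces and composing amalgams\<close>

lemma mdist_in_dist_set: "x \<in> mspace M \<Longrightarrow> y \<in> mspace M \<Longrightarrow> mdist M x y \<in> dist_set M"
  by (auto simp: dist_set_def)

lemma mdist_commute: "mdist M x y = mdist M y x"
  by (rule Metric_space.commute[OF Metric_space_mspace_mdist])

lemma mdist_triangle:
  "x \<in> mspace M \<Longrightarrow> y \<in> mspace M \<Longrightarrow> z \<in> mspace M \<Longrightarrow> mdist M x z \<le> mdist M x y + mdist M y z"
  by (rule Metric_space.triangle[OF Metric_space_mspace_mdist])

lemma mdist_pos: "x \<in> mspace M \<Longrightarrow> y \<in> mspace M \<Longrightarrow> x \<noteq> y \<Longrightarrow> 0 < mdist M x y"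
  by (rule Metric_space.mdist_pos_less[OF Metric_space_mspace_mdist])

lemma mdist_refl [simp]: "x \<in> mspace M \<Longrightarrow> mdist M x x = 0"
  by simp

text \<open>The possible shapes of a triangle with vertices on both sides: two vertices lie in the
  same space, and the edge to be bounded either joins the two spaces (\<open>sideA\<close>, \<open>sideB\<close>) or lies
  inside one of them (\<open>baseA\<close>, \<open>baseB\<close>). The function \<open>e\<close> is taken on all of
  \<open>A \<times> B\<close>, with the given values at common points, so that these four inequalities cover
  the triangles with a common vertex as well.\<close>

lemma amalgams_if_cross_distance:
  fixes e :: "'a \<Rightarrow> 'a \<Rightarrow> real"
  assumes inst: "amalgamation_instance A B"
    and dist: "dist_set A \<union> dist_set B \<subseteq> R"
    and eA: "\<And>x z. x \<in> mspace A \<Longrightarrow> z \<in> mspace A \<inter> mspace B \<Longrightarrow> e x z = mdist A x z"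
    and eB: "\<And>z y. z \<in> mspace A \<inter> mspace B \<Longrightarrow> y \<in> mspace B \<Longrightarrow> e z y = mdist B z y"
    and eR: "\<And>x y. x \<in> mspace A \<Longrightarrow> y \<in> mspace B \<Longrightarrow> e x y \<in> R"
    and pos: "\<And>x y. x \<in> mspace A - mspace B \<Longrightarrow> y \<in> mspace B - mspace A \<Longrightarrow> 0 < e x y"
    and sideA: "\<And>x x' y. x \<in> mspace A \<Longrightarrow> x' \<in> mspace A \<Longrightarrow> y \<in> mspace B
                  \<Longrightarrow> e x y \<le> mdist A x x' + e x' y"
    and sideB: "\<And>x y y'. x \<in> mspace A \<Longrightarrow> y \<in> mspace B \<Longrightarrow> y' \<in> mspace B
                  \<Longrightarrow> e x y \<le> e x y' + mdist B y' y"
    and baseA: "\<And>x x' y. x \<in> mspace A \<Longrightarrow> x' \<in> mspace A \<Longrightarrow> y \<in> mspace B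
                  \<Longrightarrow> mdist A x x' \<le> e x y + e x' y"
    and baseB: "\<And>x y y'. x \<in> mspace A \<Longrightarrow> y \<in> mspace B \<Longrightarrow> y' \<in> mspace B
                  \<Longrightarrow> mdist B y y' \<le> e x y + e x y'"
  shows "amalgams R A B \<noteq> {}"
proof -
  let ?M = "mspace A \<union> mspace B"
  define d where "d p q = (if p \<in> mspace A \<and> q \<in> mspace A then mdist A p q
     else if p \<in> mspace B \<and> q \<in> mspace B then mdist B p q
     else if p \<in> mspace A \<and> q \<in> mspace B then e p q
     else if p \<in> mspace B \<and> q \<in> mspace A then e q p else 0)" for p q
  have dA: "d p q = mdist A p q" if "p \<in> mspace A" "q \<in> mspace A" for p q
    using that by (simp add: d_def)
  have dB: "d p q = mdist B p q" if "p \<in> mspace B" "q \<in> mspace B" for p q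
    using that inst by (auto simp: d_def amalgamation_instance_def)
  have de: "d p q = e p q" "d q p = e p q" if "p \<in> mspace A" "q \<in> mspace B" for p q
    using that eA[of p q] eB[of p q] by (auto simp: d_def mdist_commute)
  have tri: "d p r \<le> d p q + d q r" if h: "p \<in> ?M" "q \<in> ?M" "r \<in> ?M" for p q r
  proof -
    consider "p \<in> mspace A" "q \<in> mspace A" "r \<in> mspace A"
      | "p \<in> mspace A" "q \<in> mspace A" "r \<in> mspace B"
      | "p \<in> mspace A" "q \<in> mspace B" "r \<in> mspace A"
      | "p \<in> mspace A" "q \<in> mspace B" "r \<in> mspace B"
      | "p \<in> mspace B" "q \<in> mspace A" "r \<in> mspace A"
      | "p \<in> mspace B" "q \<in> mspace A" "r \<in> mspace B"
      | "p \<in> mspace B" "q \<in> mspace B" "r \<in> mspace A"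
      | "p \<in> mspace B" "q \<in> mspace B" "r \<in> mspace B"
      using h by blast
    then show ?thesis
    proof cases
      case 1 then show ?thesis by (simp add: dA mdist_triangle)
    next
      case 2 then show ?thesis using sideA[of p q r] by (simp add: dA de)
    next
      case 3 then show ?thesis using baseA[of p r q] by (simp add: dA de)
    next
      case 4 then show ?thesis using sideB[of p r q] by (simp add: dB de)
    next
      case 5 then show ?thesis
        using sideA[of r q p] by (simp add: dA de mdist_commute[of A r q])
    next
      case 6 then show ?thesis using baseB[of q p r] by (simp add: dB de)
    next
      case 7 then show ?thesis
        using sideB[of r p q] by (simp add: dB de mdist_commute[of B q p])
    next
      case 8 then show ?thesis by (simp add: dB mdist_triangle)
    qed
  qed
  have d0: "d p p = 0" if "p \<in> ?M" for p
    using that by (auto simp: dA dB)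
  have dpos: "0 < d p q" if h: "p \<in> ?M" "q \<in> ?M" "p \<noteq> q" for p q
  proof -
    consider "p \<in> mspace A" "q \<in> mspace A" | "p \<in> mspace B" "q \<in> mspace B"
      | "p \<in> mspace A - mspace B" "q \<in> mspace B - mspace A"
      | "q \<in> mspace A - mspace B" "p \<in> mspace B - mspace A"
      using h by blast
    then show ?thesis
      by cases (use h pos[of p q] pos[of q p] in \<open>auto simp: dA dB de mdist_pos\<close>)
  qed
  have dsym: "d p q = d q p" for p q
    by (cases "p \<in> mspace A"; cases "p \<in> mspace B"; cases "q \<in> mspace A"; cases "q \<in> mspace B")
      (simp_all add: d_def mdist_commute[of _ p q])
  have dnonneg: "0 \<le> d p q" for p q
    using dpos[of p q] d0[of p] by (cases "p \<in> ?M \<and> q \<in> ?M \<and> p \<noteq> q") (auto simp: d_def)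
  interpret C: Metric_space ?M d
  proof unfold_locales
    show "d p q = 0 \<longleftrightarrow> p = q" if "p \<in> ?M" "q \<in> ?M" for p q
      using dpos[OF that] d0[OF that(1)] by fastforce
  qed (fact dnonneg dsym tri)+
  have "d p q \<in> R" if "p \<in> ?M" "q \<in> ?M" for p q
  proof -
    have "d p q \<in> dist_set A \<or> d p q \<in> dist_set B \<or> d p q \<in> R"
      using that by (auto simp: dA dB de eR mdist_in_dist_set)
    then show ?thesis using dist by blast
  qed
  then have "metric (?M, d) \<in> amalgams R A B"
    by (auto simp: amalgams_def dist_set_def dA dB)
  then show ?thesis by blast
qed

lemma amalgams_commute: "amalgams R A B = amalgams R B A"
  by (auto simp: amalgams_def)

lemma amalgamation_instance_commute: "amalgamation_instance A B \<longleftrightarrow> amalgamation_instance B A"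
  by (auto simp: amalgamation_instance_def)

lemma amalgams_if_subset:
  assumes "amalgamation_instance A B" "mspace A \<subseteq> mspace B" "dist_set B \<subseteq> R"
  shows "amalgams R A B \<noteq> {}"
proof -
  have "B \<in> amalgams R A B"
    using assms unfolding amalgams_def amalgamation_instance_def
    by (simp add: Un_absorb1 subset_iff)
  then show ?thesis by blast
qed

text \<open>Amalgams compose: a part of \<open>A\<close> can be glued to \<open>B\<close> first, and all of \<open>A\<close>
  to the result afterwards. Containing the common points, the part is the whole intersection of
  \<open>A\<close> with that result.\<close>

lemma amalgams_via_subspace:
  assumes "mspace A \<inter> mspace B \<subseteq> S"
    and first: "amalgams R (submetric A S) B \<noteq> {}"
    and second: "\<And>B'. amalgamation_instance A B' \<Longrightarrow> dist_set B' \<subseteq> R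
      \<Longrightarrow> mspace B' = mspace A \<inter> S \<union> mspace B \<Longrightarrow> amalgams R A B' \<noteq> {}"
  shows "amalgams R A B \<noteq> {}"
proof -
  obtain B' where B': "B' \<in> amalgams R (submetric A S) B"
    using first by blast
  then have carrier: "mspace B' = mspace A \<inter> S \<union> mspace B"
    and agree: "\<And>p q. p \<in> mspace A \<inter> S \<Longrightarrow> q \<in> mspace A \<inter> S \<Longrightarrow> mdist B' p q = mdist A p q"
    by (auto simp: amalgams_def)
  have "mspace A \<inter> mspace B' \<subseteq> mspace A \<inter> S"
    using assms(1) carrier by blast
  then have "amalgamation_instance A B'"
    unfolding amalgamation_instance_def using agree by (metis subsetD)
  moreover have "dist_set B' \<subseteq> R"
    using B' by (auto simp: amalgams_def)
  ultimately obtain C where "C \<in> amalgams R A B'"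
    using second[OF _ _ carrier] by blast
  then have "C \<in> amalgams R A B"
    using B' by (auto simp: amalgams_def)
  then show ?thesis by blast
qed

lemma amalgamation_instance_submetric:
  "amalgamation_instance A B \<Longrightarrow> amalgamation_instance (submetric A S) B"
  by (auto simp: amalgamation_instance_def)

lemma dist_set_submetric: "dist_set (submetric A S) \<subseteq> dist_set A"
  unfolding dist_set_def by auto

section \<open>Closed distance sets\<close>

text \<open>For closed \<open>R\<close> and a common point the supremum is a maximum, and it equals the infimum of
  \<open>d\<^sub>A(x,z) \<oplus> d\<^sub>B(z,y)\<close> over the common points \<open>z\<close>.\<close>

definition free_dist :: "real set \<Rightarrow> 'a metric \<Rightarrow> 'a metric \<Rightarrow> 'a \<Rightarrow> 'a \<Rightarrow> real" where
  "free_dist R A B x y = Sup {r \<in> R. \<forall>z \<in> mspace A \<inter> mspace B. r \<le> mdist A x z + mdist B z y}"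

lemma free_dist_commute: "free_dist R A B x y = free_dist R B A y x"
  by (simp add: free_dist_def mdist_commute[of A x] mdist_commute[of B _ y] Int_commute add.commute)

locale closed_amalgamation =
  fixes R :: "real set" and A B :: "'a metric"
  assumes nonneg: "R \<subseteq> {0..}" and four_values: "four_values R" and closed: "closed R"
    and inst: "amalgamation_instance A B"
    and dist: "dist_set A \<union> dist_set B \<subseteq> R"
    and common: "mspace A \<inter> mspace B \<noteq> {}"
begin

lemma distA: "x \<in> mspace A \<Longrightarrow> y \<in> mspace A \<Longrightarrow> mdist A x y \<in> R"
  using dist mdist_in_dist_set[of x A y] by blast

lemma distB: "x \<in> mspace B \<Longrightarrow> y \<in> mspace B \<Longrightarrow> mdist B x y \<in> R"
  using dist mdist_in_dist_set[of x B y] by blast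

lemma agree: "z \<in> mspace A \<inter> mspace B \<Longrightarrow> w \<in> mspace A \<inter> mspace B \<Longrightarrow> mdist A z w = mdist B z w"
  using inst by (auto simp: amalgamation_instance_def)

lemma free_dist_upper:
  assumes "r \<in> R" "\<And>z. z \<in> mspace A \<inter> mspace B \<Longrightarrow> r \<le> mdist A x z + mdist B z y"
  shows "r \<le> free_dist R A B x y"
  unfolding free_dist_def
proof (rule cSup_upper)
  obtain z where "z \<in> mspace A \<inter> mspace B" using common by blast
  then show "bdd_above {r \<in> R. \<forall>z \<in> mspace A \<inter> mspace B. r \<le> mdist A x z + mdist B z y}"
    by (intro bdd_aboveI[of _ "mdist A x z + mdist B z y"]) blast
qed (use assms in blast)

lemma free_dist_attained:
  shows free_dist_in: "free_dist R A B x y \<in> R"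
    and free_dist_le: "z \<in> mspace A \<inter> mspace B \<Longrightarrow> free_dist R A B x y \<le> mdist A x z + mdist B z y"
proof -
  let ?S = "{r \<in> R. \<forall>z \<in> mspace A \<inter> mspace B. r \<le> mdist A x z + mdist B z y}"
  obtain w where w: "w \<in> mspace A \<inter> mspace B" using common by blast
  have "0 \<in> R" using distA[of w w] w by simp
  then have "0 \<in> ?S" by simp
  moreover have "bdd_above ?S"
    using w by (intro bdd_aboveI[of _ "mdist A x w + mdist B w y"]) blast
  moreover have "closed ?S"
  proof -
    have "?S = R \<inter> (\<Inter>z \<in> mspace A \<inter> mspace B. {..mdist A x z + mdist B z y})" by auto
    then show ?thesis using closed by (simp add: closed_Int closed_INT)
  qed
  ultimately have "free_dist R A B x y \<in> ?S"
    unfolding free_dist_def using closed_contains_Sup[of ?S] by blast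
  then show "free_dist R A B x y \<in> R"
    and "z \<in> mspace A \<inter> mspace B \<Longrightarrow> free_dist R A B x y \<le> mdist A x z + mdist B z y"
    by blast+
qed

text \<open>A lower bound for a sum with \<open>free_dist\<close> can be checked at each common point
  separately, with a witness \<open>q\<close> that depends on the point: since \<open>R\<close> is closed, there is a
  least element of \<open>R\<close> that is large enough, and it lies below all of the witnesses.\<close>

lemma le_free_dist_plus:
  assumes "\<And>z. z \<in> mspace A \<inter> mspace B
             \<Longrightarrow> \<exists>q\<in>R. q \<le> mdist A x z + mdist B z y \<and> s \<le> c + q"
  shows "s \<le> c + free_dist R A B x y"
proof -
  let ?Q = "{q \<in> R. s - c \<le> q}"
  have "closed ?Q"
  proof -
    have "?Q = R \<inter> {s - c..}" by auto
    then show ?thesis using closed by (simp add: closed_Int)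
  qed
  moreover have bdd: "bdd_below ?Q" by (intro bdd_belowI[of _ "s - c"]) simp
  moreover have "?Q \<noteq> {}"
  proof -
    obtain z where "z \<in> mspace A \<inter> mspace B" using common by blast
    then obtain q where "q \<in> R" "s \<le> c + q" using assms by blast
    then have "q \<in> ?Q" by simp
    then show ?thesis by blast
  qed
  ultimately have m: "Inf ?Q \<in> ?Q" by (intro closed_contains_Inf)
  have "Inf ?Q \<le> mdist A x z + mdist B z y" if "z \<in> mspace A \<inter> mspace B" for z
  proof -
    obtain q where q: "q \<in> R" "q \<le> mdist A x z + mdist B z y" "s \<le> c + q"
      using assms \<open>z \<in> _\<close> by blast
    then have "Inf ?Q \<le> q" using bdd by (intro cInf_lower) auto
    then show ?thesis using q(2) by linarith
  qed
  then have "Inf ?Q \<le> free_dist R A B x y" using m by (intro free_dist_upper) auto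
  then show ?thesis using m by auto
qed

text \<open>Reassociation along the path \<open>x, x', z, y\<close>: the distance from \<open>x\<close> to \<open>y\<close> is at most
  that of the path cut at \<open>z\<close>, hence of the same path cut at \<open>x'\<close>.\<close>

lemma free_dist_side:
  assumes "x \<in> mspace A" "x' \<in> mspace A" "y \<in> mspace B"
  shows "free_dist R A B x y \<le> mdist A x x' + free_dist R A B x' y"
proof (rule le_free_dist_plus)
  fix z assume z: "z \<in> mspace A \<inter> mspace B"
  have "mdist A x z \<le> mdist A x x' + mdist A x' z"
    using assms z by (simp add: mdist_triangle)
  then show "\<exists>q\<in>R. q \<le> mdist A x' z + mdist B z y \<and> free_dist R A B x y \<le> mdist A x x' + q"
    using free_dist_le[OF z, of x y] assms z
    by (intro four_values_reassociate[OF four_values nonneg, where t = "mdist A x z"]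
        free_dist_in distA distB) auto
qed

lemma free_dist_common:
  assumes "x \<in> mspace A" "z \<in> mspace A \<inter> mspace B"
  shows "free_dist R A B x z = mdist A x z"
proof (rule antisym)
  show "free_dist R A B x z \<le> mdist A x z"
    using free_dist_le[OF assms(2), of x z] assms(2) by simp
  show "mdist A x z \<le> free_dist R A B x z"
    using assms mdist_triangle[of x A _ z] by (intro free_dist_upper distA) (auto simp: agree[symmetric])
qed

lemma swapped: "closed_amalgamation R B A"
  using nonneg four_values closed inst dist common
  by unfold_locales (auto simp: amalgamation_instance_commute)

text \<open>For a common point \<open>z\<close>, the path \<open>x, z, y, x'\<close> may be cut at \<open>z\<close>, by the triangle
  inequality in \<open>A\<close> and by \<open>free_dist_side\<close> for the roles of \<open>A\<close> and \<open>B\<close>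
  exchanged; reassociation cuts it at \<open>y\<close>.\<close>

lemma free_dist_base:
  assumes "x \<in> mspace A" "x' \<in> mspace A" "y \<in> mspace B"
  shows "mdist A x x' \<le> free_dist R A B x y + free_dist R A B x' y"
proof -
  interpret swapped: closed_amalgamation R B A by (rule swapped)
  have "mdist A x x' \<le> free_dist R A B x' y + free_dist R A B x y"
  proof (rule le_free_dist_plus)
    fix z assume z: "z \<in> mspace A \<inter> mspace B"
    have zx': "mdist A z x' \<le> mdist B z y + free_dist R A B x' y"
      using swapped.free_dist_side[of z y x'] free_dist_common[of x' z] assms z
      by (simp add: free_dist_commute[of R B A] mdist_commute[of A z])
    have xx': "mdist A x x' \<le> mdist A z x' + mdist A x z"
      using mdist_triangle[of x A z x'] assms z by simp
    have "\<exists>q\<in>R. q \<le> mdist B z y + mdist A x z \<and> mdist A x x' \<le> free_dist R A B x' y + q"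
      using zx' xx' assms z
      by (intro four_values_reassociate[OF four_values nonneg, where t = "mdist A z x'"]
          free_dist_in distA distB) auto
    then show "\<exists>q\<in>R. q \<le> mdist A x z + mdist B z y \<and> mdist A x x' \<le> free_dist R A B x' y + q"
      by (simp add: add.commute)
  qed
  then show ?thesis by simp
qed

lemma amalgam_exists:
  assumes "separated_instance R A B"
  shows "amalgams R A B \<noteq> {}"
proof -
  interpret swapped: closed_amalgamation R B A by (rule swapped)
  note swap = free_dist_commute[of R B A]
  show ?thesis
  proof (rule amalgams_if_cross_distance[where e = "free_dist R A B"])
    fix x y assume "x \<in> mspace A - mspace B" "y \<in> mspace B - mspace A"
    then obtain r where "r \<in> R" "0 < r" "\<forall>z \<in> mspace A \<inter> mspace B. r \<le> mdist A x z + mdist B z y"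
      using assms unfolding separated_instance_def by blast
    then show "0 < free_dist R A B x y" using free_dist_upper[of r x y] by auto
  next
    fix z y assume "z \<in> mspace A \<inter> mspace B" "y \<in> mspace B"
    then show "free_dist R A B z y = mdist B z y"
      using swapped.free_dist_common[of y z] by (simp add: swap Int_commute mdist_commute[of B y])
  next
    fix x y y' assume "x \<in> mspace A" "y \<in> mspace B" "y' \<in> mspace B"
    then show "free_dist R A B x y \<le> free_dist R A B x y' + mdist B y' y"
      using swapped.free_dist_side[of y y' x] by (simp add: swap mdist_commute[of B y'])
  next
    fix x y y' assume "x \<in> mspace A" "y \<in> mspace B" "y' \<in> mspace B"
    then show "mdist B y y' \<le> free_dist R A B x y + free_dist R A B x y'"
      using swapped.free_dist_base[of y y' x] by (simp add: swap)
  qed (use inst dist free_dist_common free_dist_in free_dist_side free_dist_base in auto)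
qed

end

section \<open>Finite spaces\<close>

lemma amalgams_one_point_each:
  assumes "amalgamation_instance A B" "dist_set A \<union> dist_set B \<subseteq> R"
    and x: "mspace A - mspace B = {x}" and y: "mspace B - mspace A = {y}"
    and "r \<in> R" "0 < r"
    and bounds: "\<And>z. z \<in> mspace A \<inter> mspace B \<Longrightarrow> metric_triple r (mdist A x z) (mdist B z y)"
  shows "amalgams R A B \<noteq> {}"
proof -
  let ?Z = "mspace A \<inter> mspace B"
  define e where "e p q = (if q \<in> mspace A then mdist A p q else if p \<in> mspace B then mdist B p q else r)"
    for p q
  have MA: "mspace A = insert x ?Z" "x \<notin> mspace B" and MB: "mspace B = insert y ?Z" "y \<notin> mspace A"
    using x y by blast+
  have agree: "mdist A z w = mdist B z w" if "z \<in> ?Z" "w \<in> ?Z" for z w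
    using assms(1) that by (auto simp: amalgamation_instance_def)
  have eA: "e p z = mdist A p z" if "z \<in> ?Z" for p z
    using that by (simp add: e_def)
  have eB: "e z q = mdist B z q" if "z \<in> ?Z" "q \<in> mspace B" for z q
    using that agree[of z q] by (auto simp: e_def)
  have er: "e x y = r" using MA MB by (simp add: e_def)
  have b: "r \<le> mdist A x z + mdist B z y" "mdist A x z \<le> r + mdist B z y" "mdist B z y \<le> r + mdist A x z"
    if "z \<in> ?Z" for z
    using bounds[OF that] by (auto simp: metric_triple_def)
  show ?thesis
  proof (rule amalgams_if_cross_distance[where e = e])
    fix p q assume pq: "p \<in> mspace A" "q \<in> mspace B"
    have "e p q \<in> dist_set A \<union> dist_set B \<or> e p q = r"
      using pq by (auto simp: e_def mdist_in_dist_set)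
    then show "e p q \<in> R" using assms by blast
  next
    fix p p' q assume h: "p \<in> mspace A" "p' \<in> mspace A" "q \<in> mspace B"
    consider "q \<in> ?Z" | "q = y" "p \<in> ?Z" "p' \<in> ?Z" | "q = y" "p = x" "p' = x"
      | "q = y" "p = x" "p' \<in> ?Z" | "q = y" "p \<in> ?Z" "p' = x"
      using h MA MB by blast
    note cs = this
    show "e p q \<le> mdist A p p' + e p' q"
      using cs
    proof cases
      case 1 then show ?thesis using h mdist_triangle[of p A p' q] by (simp add: eA)
      next
      case 2 then show ?thesis using h mdist_triangle[of p B p' q] by (simp add: eB agree)
      next
      case 3 then show ?thesis using h by simp
      next
      case 4 then show ?thesis using h er b[of p'] by (simp add: eB)
      next
      case 5 then show ?thesis using h er b[of p] by (simp add: eB mdist_commute[of A p x])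
    qed
    show "mdist A p p' \<le> e p q + e p' q"
      using cs
    proof cases
      case 1 then show ?thesis using h mdist_triangle[of p A q p'] by (simp add: eA mdist_commute[of A p' q])
      next
      case 2 then show ?thesis using h mdist_triangle[of p B q p'] by (simp add: eB agree mdist_commute[of B _ y])
      next
      case 3 then show ?thesis using h er \<open>0 < r\<close> by simp
      next
      case 4 then show ?thesis using h er b[of p'] by (simp add: eB)
      next
      case 5 then show ?thesis using h er b[of p] by (simp add: eB mdist_commute[of A p x])
    qed
  next
    fix p q q' assume h: "p \<in> mspace A" "q \<in> mspace B" "q' \<in> mspace B"
    consider "p \<in> ?Z" | "p = x" "q \<in> ?Z" "q' \<in> ?Z" | "p = x" "q = y" "q' = y"
      | "p = x" "q = y" "q' \<in> ?Z" | "p = x" "q \<in> ?Z" "q' = y"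
      using h MA MB by blast
    note cs = this
    show "e p q \<le> e p q' + mdist B q' q"
      using cs
    proof cases
      case 1 then show ?thesis using h mdist_triangle[of p B q' q] by (simp add: eB)
      next
      case 2 then show ?thesis using h mdist_triangle[of p A q' q] by (simp add: eA agree[symmetric])
      next
      case 3 then show ?thesis using h by simp
      next
      case 4 then show ?thesis using h er b[of q'] by (simp add: eA)
      next
      case 5 then show ?thesis using h er b[of q] by (simp add: eA mdist_commute[of B y q])
    qed
    show "mdist B q q' \<le> e p q + e p q'"
      using cs
    proof cases
      case 1 then show ?thesis using h mdist_triangle[of q B p q'] by (simp add: eB mdist_commute[of B p q])
      next
      case 2 then show ?thesis using h mdist_triangle[of q A p q'] by (simp add: eA agree[symmetric] mdist_commute[of A _ x])
      next
      case 3 then show ?thesis using h er \<open>0 < r\<close> by simp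
      next
      case 4 then show ?thesis using h er b[of q'] by (simp add: eA mdist_commute[of B y q'])
      next
      case 5 then show ?thesis using h er b[of q] by (simp add: eA)
    qed
  qed (use assms eA eB er in auto)
qed

lemma finite_minimizer:
  fixes f :: "'a \<Rightarrow> 'b::linorder"
  assumes "finite S" "S \<noteq> {}"
  obtains m where "m \<in> S" "\<And>x. x \<in> S \<Longrightarrow> f m \<le> f x"
  by (rule that[OF arg_min_if_finite(1)[OF assms] arg_min_least[OF assms]])

text \<open>The distance from \<open>x\<close> to its nearest common point is a positive
  element of \<open>R\<close> below all the upper bounds, whatever \<open>y\<close> is.\<close>

lemma separated_if_common_finite:
  assumes "finite (mspace A \<inter> mspace B)" "mspace A \<inter> mspace B \<noteq> {}" "dist_set A \<union> dist_set B \<subseteq> R"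
  shows "separated_instance R A B"
  unfolding separated_instance_def
proof (intro ballI)
  fix x y assume x: "x \<in> mspace A - mspace B" and y: "y \<in> mspace B - mspace A"
  obtain w where w: "w \<in> mspace A \<inter> mspace B"
      and min: "\<And>z. z \<in> mspace A \<inter> mspace B \<Longrightarrow> mdist A x w \<le> mdist A x z"
    by (rule finite_minimizer[OF assms(1,2), of "mdist A x"]) blast
  have "mdist A x w \<in> R" using w x assms(3) mdist_in_dist_set[of x A w] by blast
  moreover have "0 < mdist A x w" using w x by (intro mdist_pos) auto
  moreover have "mdist A x w \<le> mdist A x z + mdist B z y" if "z \<in> mspace A \<inter> mspace B" for z
    using min[OF that] mdist_nonneg[of B z y] by linarith
  ultimately show "\<exists>r\<in>R. 0 < r \<and> (\<forall>z \<in> mspace A \<inter> mspace B. r \<le> mdist A x z + mdist B z y)"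
    by blast
qed

text \<open>The best lower bound and the best upper bound come from two common points \<open>z\<close> and
  \<open>w\<close>, so a value that suits these two suits all of them.\<close>

lemma finite_one_point_distance:
  assumes "R \<subseteq> {0..}" "four_values R" "amalgamation_instance A B" "dist_set A \<union> dist_set B \<subseteq> R"
    and fin: "finite (mspace A \<inter> mspace B)" and common: "mspace A \<inter> mspace B \<noteq> {}"
    and x: "x \<in> mspace A - mspace B" and y: "y \<in> mspace B - mspace A"
  obtains r where "r \<in> R" "0 < r"
    "\<And>z. z \<in> mspace A \<inter> mspace B \<Longrightarrow> metric_triple r (mdist A x z) (mdist B z y)"
proof -
  let ?Z = "mspace A \<inter> mspace B"
  let ?l = "\<lambda>z. \<bar>mdist A x z - mdist B z y\<bar>" and ?u = "\<lambda>z. mdist A x z + mdist B z y"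
  have dA: "mdist A p q \<in> R" if "p \<in> mspace A" "q \<in> mspace A" for p q
    using assms(4) mdist_in_dist_set[OF that] by blast
  have dB: "mdist B p q \<in> R" if "p \<in> mspace B" "q \<in> mspace B" for p q
    using assms(4) mdist_in_dist_set[OF that] by blast
  have triple: "metric_triple r (mdist A x z) (mdist B z y)" if "?l z \<le> r" "r \<le> ?u z" for r z
    using that by (auto simp: metric_triple_def)
  obtain z where z: "z \<in> ?Z" and max: "\<And>z'. z' \<in> ?Z \<Longrightarrow> ?l z' \<le> ?l z"
    by (rule finite_minimizer[OF fin common, of "\<lambda>z. - ?l z"]) auto
  obtain w where w: "w \<in> ?Z" and min: "\<And>z'. z' \<in> ?Z \<Longrightarrow> ?u w \<le> ?u z'"
    by (rule finite_minimizer[OF fin common, of ?u]) blast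
  show thesis
  proof (cases "?l z = 0")
    case True
    \<comment> \<open>All lower bounds vanish, and the quadrilateral could yield the value 0;
      a positive value below all upper bounds comes from the nearest common point.\<close>
    obtain r where "r \<in> R" "0 < r" "\<forall>z' \<in> ?Z. r \<le> ?u z'"
      using separated_if_common_finite[OF fin common assms(4)] x y
      unfolding separated_instance_def by blast
    moreover have "?l z' \<le> r" if "z' \<in> ?Z" for z'
      using max[OF that] True \<open>0 < r\<close> by linarith
    ultimately show thesis using that triple by blast
  next
    case False
    have agree: "mdist A z w = mdist B z w"
      using assms(3) z w by (auto simp: amalgamation_instance_def)
    have "metric_triple (mdist A z w) (mdist A x z) (mdist A x w)"
      using x z w mdist_triangle[of x A z w] mdist_triangle[of x A w z] mdist_triangle[of z A x w]
      by (auto simp: metric_triple_def mdist_commute[of A w z] mdist_commute[of A z x])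
    moreover have "metric_triple (mdist A z w) (mdist B w y) (mdist B z y)"
      using y z w mdist_triangle[of z B w y] mdist_triangle[of w B z y] mdist_triangle[of z B y w]
      by (auto simp: metric_triple_def agree mdist_commute[of B w z] mdist_commute[of B y w])
    ultimately obtain r where r: "r \<in> R" "metric_triple r (mdist A x z) (mdist B z y)"
        "metric_triple r (mdist A x w) (mdist B w y)"
      using four_values_quadrilateral[OF assms(2), of "mdist A z w" "mdist A x z" "mdist A x w"
          "mdist B w y" "mdist B z y"] dA dB x y z w by blast
    have lu: "?l z \<le> r" "r \<le> ?u w" using r by (auto simp: metric_triple_def)
    show thesis
    proof
      show "0 < r" using lu False by linarith
      show "metric_triple r (mdist A x z') (mdist B z' y)" if "z' \<in> ?Z" for z'
        using triple lu max[OF that] min[OF that] by (meson order_trans)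
    qed (fact r)
  qed
qed

text \<open>Induction on the number of points outside the intersection. If \<open>A\<close> has at least two of
  them, first one point \<open>x\<close> of them is glued to \<open>B\<close> together with the common points, then all
  of \<open>A\<close>; in the second step \<open>x\<close> is a common point. Both steps have fewer points outside
  the intersection, and what remains is that one space
  contains the other or that each has exactly one point outside.\<close>

lemma amalgams_finite_common:
  fixes A B :: "'a metric"
  assumes "R \<subseteq> {0..}" "four_values R" "amalgamation_instance A B" "dist_set A \<union> dist_set B \<subseteq> R"
    and "finite (mspace A \<union> mspace B)" "mspace A \<inter> mspace B \<noteq> {}"
  shows "amalgams R A B \<noteq> {}"
  using assms(3-)
proof (induction "card (mspace A - mspace B) + card (mspace B - mspace A)" arbitrary: A B
    rule: less_induct)
  case less
  have many: "amalgams R A' B' \<noteq> {}"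
    if h: "amalgamation_instance A' B'" "dist_set A' \<union> dist_set B' \<subseteq> R"
      "finite (mspace A' \<union> mspace B')" "mspace A' \<inter> mspace B' \<noteq> {}"
      and card: "card (mspace A' - mspace B') + card (mspace B' - mspace A')
        = card (mspace A - mspace B) + card (mspace B - mspace A)"
      and x: "x \<in> mspace A' - mspace B'" and ne: "mspace A' - mspace B' \<noteq> {x}" for A' B' :: "'a metric" and x
  proof (rule amalgams_via_subspace)
    let ?S = "insert x (mspace A' \<inter> mspace B')"
    show "mspace A' \<inter> mspace B' \<subseteq> ?S" by blast
    have sub: "{x} \<subset> mspace A' - mspace B'" using x ne by blast
    show "amalgams R (submetric A' ?S) B' \<noteq> {}"
    proof (rule less.hyps)
      have "mspace (submetric A' ?S) - mspace B' = {x}"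
           "mspace B' - mspace (submetric A' ?S) = mspace B' - mspace A'" using x by auto
      moreover have "card {x} < card (mspace A' - mspace B')"
        using sub h(3) by (intro psubset_card_mono) auto
      ultimately show "card (mspace (submetric A' ?S) - mspace B')
          + card (mspace B' - mspace (submetric A' ?S))
        < card (mspace A - mspace B) + card (mspace B - mspace A)"
        using card by simp
    qed (use h dist_set_submetric[of A' ?S] in \<open>auto simp: amalgamation_instance_submetric\<close>)
    fix B'' assume B'': "amalgamation_instance A' B''" "dist_set B'' \<subseteq> R"
      "mspace B'' = mspace A' \<inter> ?S \<union> mspace B'"
    show "amalgams R A' B'' \<noteq> {}"
    proof (rule less.hyps)
      have "mspace A' - mspace B'' \<subset> mspace A' - mspace B'"
        "mspace B'' - mspace A' = mspace B' - mspace A'"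
        using x B''(3) by auto
      moreover from this(1) have "card (mspace A' - mspace B'') < card (mspace A' - mspace B')"
        using h(3) by (intro psubset_card_mono) auto
      ultimately show "card (mspace A' - mspace B'') + card (mspace B'' - mspace A')
        < card (mspace A - mspace B) + card (mspace B - mspace A)"
        using card by simp
    qed (use h B'' in auto)
  qed
  show ?case
  proof (cases "mspace A \<subseteq> mspace B \<or> mspace B \<subseteq> mspace A")
    case True
    then show ?thesis
      using amalgams_if_subset[of A B R] amalgams_if_subset[of B A R] less.prems
      by (auto simp: amalgams_commute[of R B A] amalgamation_instance_commute[of B A])
  next
    case False
    then obtain x y where x: "x \<in> mspace A - mspace B" and y: "y \<in> mspace B - mspace A" by blast
    consider "mspace A - mspace B \<noteq> {x}" | "mspace B - mspace A \<noteq> {y}"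
      | "mspace A - mspace B = {x}" "mspace B - mspace A = {y}" by blast
    then show ?thesis
    proof cases
      case 1
      show ?thesis by (rule many[OF less.prems refl x 1])
    next
      case 2
      have "amalgams R B A \<noteq> {}"
        using less.prems
        by (intro many[OF _ _ _ _ _ y 2]) (auto simp: amalgamation_instance_commute[of B A])
      then show ?thesis by (simp add: amalgams_commute)
    next
      case 3
      obtain r where "r \<in> R" "0 < r"
        "\<And>z. z \<in> mspace A \<inter> mspace B \<Longrightarrow> metric_triple r (mdist A x z) (mdist B z y)"
        using finite_one_point_distance[OF assms(1,2) less.prems(1,2) _ less.prems(4) x y]
          less.prems(3) by blast
      then show ?thesis
        using amalgams_one_point_each[OF less.prems(1,2) 3] by blast
    qed
  qed
qed

section \<open>Disjoint spaces and the general case\<close>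

lemma amalgams_if_common_point:
  assumes "R \<subseteq> {0..}" "four_values R" "amalgamation_instance A B" "dist_set A \<union> dist_set B \<subseteq> R"
    and "finite (mspace A \<union> mspace B) \<or> closed R" "separated_instance R A B"
    and "mspace A \<inter> mspace B \<noteq> {}"
  shows "amalgams R A B \<noteq> {}"
proof (cases "closed R")
  case True
  then interpret closed_amalgamation R A B
    using assms by unfold_locales auto
  show ?thesis by (rule amalgam_exists[OF assms(6)])
next
  case False
  then show ?thesis using amalgams_finite_common assms by blast
qed

theorem theorem3p1:
  fixes R :: "real set" and A B :: "'a metric"
  assumes "R \<subseteq> {0..}"
    and "four_values R"
    and "amalgamation_instance A B"
    and "dist_set A \<union> dist_set B \<subseteq> R"
    and "finite (mspace A \<union> mspace B) \<or> closed R"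
    and "separated_instance R A B"
  shows "amalgams R A B \<noteq> {}"
proof (cases "mspace A \<inter> mspace B = {}")
  case False
  then show ?thesis using amalgams_if_common_point assms by blast
next
  case disjoint: True
  have over_point: "amalgams R A' B' \<noteq> {}"
    if "amalgamation_instance A' B'" "dist_set A' \<union> dist_set B' \<subseteq> R"
      "finite (mspace A' \<union> mspace B') \<or> closed R" "mspace A' \<inter> mspace B' = {p}"
    for A' B' :: "'a metric" and p
    using amalgams_if_common_point[OF assms(1,2) that(1-3)] separated_if_common_finite[of A' B' R] that
    by simp
  show ?thesis
  proof (cases "mspace A = {} \<or> mspace B = {}")
    case True
    then show ?thesis
      using amalgams_if_subset[of A B R] amalgams_if_subset[of B A R] assms
      by (auto simp: amalgams_commute[of R B A] amalgamation_instance_commute[of B A])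
  next
    case False
    then obtain a b where a: "a \<in> mspace A" and b: "b \<in> mspace B" by blast
    then obtain r where r: "r \<in> R" "0 < r"
      using assms(6) disjoint unfolding separated_instance_def by blast
    let ?a = "submetric A {a}" and ?b = "submetric B {b}"
    have "amalgams R ?b ?a \<noteq> {}"
    proof (rule amalgams_one_point_each[where r = r])
      show "amalgamation_instance ?b ?a" "mspace ?b - mspace ?a = {b}" "mspace ?a - mspace ?b = {a}"
        using a b disjoint by (auto simp: amalgamation_instance_def)
      show "metric_triple r (mdist ?b b z) (mdist ?a z a)" if "z \<in> mspace ?b \<inter> mspace ?a" for z
        using that a b disjoint by auto
    qed (use r assms(4) dist_set_submetric[of A "{a}"] dist_set_submetric[of B "{b}"] in auto)
    then have "amalgams R B ?a \<noteq> {}"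
    proof (rule amalgams_via_subspace[rotated])
      show "amalgams R B D \<noteq> {}"
        if "amalgamation_instance B D" "dist_set D \<subseteq> R" "mspace D = mspace B \<inter> {b} \<union> mspace ?a" for D
        using that a b disjoint assms(4,5) by (intro over_point[of B D b]) auto
    qed (use a disjoint in auto)
    then have "amalgams R ?a B \<noteq> {}" by (simp add: amalgams_commute)
    then show ?thesis
    proof (rule amalgams_via_subspace[rotated])
      show "amalgams R A D \<noteq> {}"
        if "amalgamation_instance A D" "dist_set D \<subseteq> R" "mspace D = mspace A \<inter> {a} \<union> mspace B" for D
        using that a b disjoint assms(4,5) by (intro over_point[of A D a]) auto
    qed (use disjoint in auto)
  qed
qed

end
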